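(* Let $Q\in\mathbb{R}^{n\times n}$ be symmetric with $\lambda_Q<0$, let $g\in\mathbb{R}^n$, $A\in\mathbb{R}^{m\times n}$, $b\in\mathbb{R}^m$, and let $\mathcal{K}\subseteq\mathbb{R}^m$ be a closed convex cone such that $\{y\in\mathbb{R}^n:\|y\|\le 1,\ Ay-b\in\mathcal{K}\}$ is nonempty. Suppose that there exists a vector $d\in\mathbb{R}^n$, $d\neq0$, such that $Qd=\lambda_Q d$, $Ad\in\mathcal{K}$ and $-Ad\in\mathcal{K}$. Then $$\overline{\mathrm{conv}}\left(\mathcal{F}_0^+\cap\mathcal{F}_1\cap\widehat{\mathcal{K}}\cap H^1\right)=\mathcal{F}_0^+\cap\mathcal{F}_s\cap\widehat{\mathcal{K}}\cap H^1,$$ where the sets $\mathcal{F}_0^+,\mathcal{F}_1,\widehat{\mathcal{K}},H^1,\mathcal{F}_s\subseteq\mathbb{R}^{n+2}$ are as defined in the context.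
   Context: $\|\cdot\|$ is the Euclidean norm, $\lambda_Q:=\lambda_{\min}(Q)$ is the minimum eigenvalue of $Q$, and $\overline{\mathrm{conv}}$ denotes the closed convex hull. Points of $\mathbb{R}^{n+2}$ are written $x=[y;x_{n+1};x_{n+2}]$ with $y\in\mathbb{R}^n$ and $x_{n+1},x_{n+2}\in\mathbb{R}$. Define $$\mathcal{F}_0^+=\{x:\ \|y\|^2\le x_{n+1}^2,\ x_{n+1}\ge 0\},$$ $$\mathcal{F}_1=\{x:\ y^\top Qy+2g^\top y\,x_{n+1}\le x_{n+1}x_{n+2}\},$$ $$\widehat{\mathcal{K}}=\{x:\ Ay-b\,x_{n+1}\in\mathcal{K}\},\qquad H^1=\{x:\ x_{n+1}=1\},$$ $$\mathcal{F}_s=\{x:\ y^\top(Q-\lambda_Q I_n)y+2g^\top y\,x_{n+1}+\lambda_Q x_{n+1}^2\le x_{n+1}x_{n+2}\}.$$ *)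

theory Defs
  imports "HOL-Analysis.Analysis"
begin

definition eigenvalue :: "real ^ 'n ^ 'n \<Rightarrow> real \<Rightarrow> bool" where
  "eigenvalue Q l \<longleftrightarrow> (\<exists>v. v \<noteq> 0 \<and> Q *v v = l *\<^sub>R v)"

text \<open>For symmetric \<open>Q\<close> the real eigenvalues form a nonempty finite set, so the least one exists;
  the value is unspecified for a matrix without real eigenvalues.\<close>

definition min_eigenvalue :: "real ^ 'n ^ 'n \<Rightarrow> real" where
  "min_eigenvalue Q = (LEAST l. eigenvalue Q l)"

text \<open>A point \<open>[y; s; t]\<close> of Euclidean \<open>(n + 2)\<close>-space is represented as the triple \<open>(y, s, t)\<close>,
  where \<open>s\<close> and \<open>t\<close> are the coordinates \<open>n + 1\<close> and \<open>n + 2\<close>.  The norm, topology and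
  vector space structure of the product type are those of Euclidean \<open>(n + 2)\<close>-space.\<close>

type_synonym 'n point = "(real ^ 'n) \<times> real \<times> real"

definition F0_plus :: "('n::finite) point set" where
  "F0_plus = {(y, s, t). (norm y)\<^sup>2 \<le> s\<^sup>2 \<and> s \<ge> 0}"

definition F1 :: "real ^ 'n ^ 'n \<Rightarrow> real ^ 'n \<Rightarrow> ('n::finite) point set" where
  "F1 Q g = {(y, s, t). y \<bullet> (Q *v y) + 2 * (g \<bullet> y) * s \<le> s * t}"

definition K_hat ::
  "real ^ 'n ^ 'm \<Rightarrow> real ^ 'm \<Rightarrow> (real ^ 'm) set \<Rightarrow> ('n::finite) point set" where
  "K_hat A b K = {(y, s, t). A *v y - s *\<^sub>R b \<in> K}"

definition H1 :: "('n::finite) point set" where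
  "H1 = {(y, s, t). s = 1}"

definition Fs :: "real ^ 'n ^ 'n \<Rightarrow> real ^ 'n \<Rightarrow> ('n::finite) point set" where
  "Fs Q g = {(y, s, t).
     y \<bullet> ((Q - min_eigenvalue Q *\<^sub>R mat 1) *v y) + 2 * (g \<bullet> y) * s + min_eigenvalue Q * s\<^sup>2
       \<le> s * t}"

end

theory Submission
  imports Defs
begin

text \<open>On the slice \<open>s = 1\<close> the inequality of \<open>Fs\<close> arises from that of \<open>F1\<close> by adding
  \<open>\<lambda> (1 - \<parallel>y\<parallel>\<^sup>2)\<close> with \<open>\<lambda> < 0\<close>, so it is weaker on the unit ball and equivalent on the unit sphere;
  it is convex because \<open>Q - \<lambda> I\<close> is positive semidefinite.  Along the eigenvector \<open>d\<close> its left-hand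
  side is affine, and moving along \<open>\<plusminus>d\<close> stays in the cone constraint.  Hence every point of the
  right-hand side lies on a segment in direction \<open>d\<close> whose end points are on the unit sphere, and
  thus belong to \<open>F1\<close>.\<close>

lemma symmetric_inner_commute:
  fixes B :: "real ^ 'n ^ 'n"
  assumes "transpose B = B"
  shows "x \<bullet> (B *v y) = y \<bullet> (B *v x)"
  by (metis assms dot_lmul_matrix inner_commute transpose_matrix_vector)

text \<open>Symmetry merges the two cross terms. The expansion serves three times: to perturb a zero
  of the form, to prove convexity, and to move along an eigenvector.\<close>

lemma quadratic_form_add_scaled:
  fixes B :: "real ^ 'n ^ 'n"
  assumes "transpose B = B"
  shows "(x + c *\<^sub>R w) \<bullet> (B *v (x + c *\<^sub>R w))
    = x \<bullet> (B *v x) + 2 * c * (w \<bullet> (B *v x)) + c\<^sup>2 * (w \<bullet> (B *v w))"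
  using symmetric_inner_commute[OF assms, of x w]
  by (simp add: matrix_vector_right_distrib matrix_vector_mult_scaleR inner_add_left
      inner_add_right power2_eq_square algebra_simps)

text \<open>A zero of a nonnegative form is a minimum, so the first-order term must vanish there. In
  direction \<open>B *v v\<close> the derivative is twice the squared norm of
  \<open>B *v v\<close>.\<close>

lemma psd_quadratic_form_eq_0D:
  fixes B :: "real ^ 'n ^ 'n"
  assumes sym: "transpose B = B" and psd: "\<And>x. 0 \<le> x \<bullet> (B *v x)"
    and v: "v \<bullet> (B *v v) = 0"
  shows "B *v v = 0"
proof -
  define w p q where "w = B *v v" and "p = w \<bullet> w" and "q = w \<bullet> (B *v w)"
  have q: "q \<ge> 0" using psd by (simp add: q_def)
  \<comment> \<open>A step against the gradient; \<open>q + 1\<close> keeps the denominator positive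
    even if \<open>q = 0\<close>, and substituting \<open>p\<close> back turns the form into a
    nonpositive multiple of \<open>c\<close> squared.\<close>
  define c where "c = - p / (q + 1)"
  have c: "c * (q + 1) = - p" using q by (simp add: c_def)
  have "0 \<le> 2 * c * p + c\<^sup>2 * q"
    using psd[of "v + c *\<^sub>R w"] v
    by (simp add: quadratic_form_add_scaled[OF sym] p_def q_def flip: w_def)
  also have "p = - (c * (q + 1))" using c by simp
  also have "2 * c * - (c * (q + 1)) + c\<^sup>2 * q = - (c\<^sup>2 * (q + 2))"
    by (simp add: power2_eq_square algebra_simps)
  finally have "c\<^sup>2 * (q + 2) \<le> 0" by simp
  then have "c = 0"
    using q by (simp add: mult_le_0_iff)
  then have "p = 0" using c by simp
  then show ?thesis by (simp add: p_def w_def)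
qed

lemma shifted_matrix_vector:
  fixes Q :: "real ^ 'n ^ 'n"
  shows "(Q - l *\<^sub>R mat 1) *v x = Q *v x - l *\<^sub>R x"
  by (simp only: matrix_vector_mult_diff_rdistrib scaleR_matrix_vector_assoc[symmetric]
      matrix_vector_mul_lid)

lemma transpose_shifted:
  fixes Q :: "real ^ 'n ^ 'n"
  assumes "transpose Q = Q"
  shows "transpose (Q - l *\<^sub>R mat 1) = Q - l *\<^sub>R mat 1"
  using assms by (simp add: transpose_def vec_eq_iff mat_def)

text \<open>By compactness the form attains a minimum \<open>l\<close> on the unit sphere. It
  remains to identify \<open>l\<close> with the least eigenvalue, which also shows that the
  \<open>LEAST\<close> in the definition is attained.\<close>

lemma min_eigenvalue_le_Rayleigh:
  fixes Q :: "real ^ 'n ^ 'n"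
  assumes sym: "transpose Q = Q"
  shows "min_eigenvalue Q * (x \<bullet> x) \<le> x \<bullet> (Q *v x)"
proof -
  have "continuous_on (sphere 0 1) (\<lambda>x. x \<bullet> (Q *v x))"
    by (intro continuous_intros linear_continuous_on matrix_vector_mul_bounded_linear)
  moreover have "sphere (0::real^'n) 1 \<noteq> {}" by simp
  ultimately have "\<exists>v\<in>sphere 0 1. \<forall>x\<in>sphere 0 1. v \<bullet> (Q *v v) \<le> x \<bullet> (Q *v x)"
    by (intro continuous_attains_inf compact_sphere)
  then obtain v where v: "norm v = 1"
    and min: "\<And>x. norm x = 1 \<Longrightarrow> v \<bullet> (Q *v v) \<le> x \<bullet> (Q *v x)"
    by auto
  define l where "l = v \<bullet> (Q *v v)"
  have bound: "l * (x \<bullet> x) \<le> x \<bullet> (Q *v x)" for x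
  proof (cases "x = 0")
    case False
    define u where "u = x /\<^sub>R norm x"
    have x: "x = norm x *\<^sub>R u" using False by (simp add: u_def)
    have "norm u = 1" using False by (simp add: u_def)
    then have "(norm x)\<^sup>2 * l \<le> (norm x)\<^sup>2 * (u \<bullet> (Q *v u))"
      using min by (simp add: l_def mult_left_mono)
    also have "\<dots> = x \<bullet> (Q *v x)"
      unfolding arg_cong[OF x, of "\<lambda>z. z \<bullet> (Q *v z)"]
      by (simp add: matrix_vector_mult_scaleR power2_eq_square)
    finally show ?thesis by (simp add: power2_norm_eq_inner mult.commute)
  qed simp
  \<comment> \<open>The shifted form is nonnegative by \<open>bound\<close> and vanishes at the
    minimiser, so \<open>v\<close> is an eigenvector without any use of Lagrange
    multipliers.\<close>
  have "(Q - l *\<^sub>R mat 1) *v v = 0"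
  proof (rule psd_quadratic_form_eq_0D[OF transpose_shifted[OF sym]])
    show "0 \<le> x \<bullet> ((Q - l *\<^sub>R mat 1) *v x)" for x
      using bound by (simp add: shifted_matrix_vector inner_diff_right)
    show "v \<bullet> ((Q - l *\<^sub>R mat 1) *v v) = 0"
      using v by (simp add: shifted_matrix_vector inner_diff_right l_def dot_square_norm)
  qed
  then have "eigenvalue Q l"
    using v unfolding eigenvalue_def by (intro exI[of _ v]) (auto simp: shifted_matrix_vector)
  moreover have "l \<le> m" if m: "eigenvalue Q m" for m
  proof -
    obtain w where "w \<noteq> 0" "Q *v w = m *\<^sub>R w" using m unfolding eigenvalue_def by blast
    then show ?thesis using bound[of w] by simp
  qed
  ultimately have "min_eigenvalue Q = l"
    unfolding min_eigenvalue_def by (rule Least_equality)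
  then show ?thesis using bound by simp
qed

text \<open>The chord exceeds the form by exactly \<open>c * (1 - c)\<close> times the form at
  \<open>y - x\<close>.\<close>

lemma convex_on_psd_quadratic_form:
  fixes B :: "real ^ 'n ^ 'n"
  assumes sym: "transpose B = B" and psd: "\<And>x. 0 \<le> x \<bullet> (B *v x)"
  shows "convex_on UNIV (\<lambda>x. x \<bullet> (B *v x))"
proof (rule convex_onI)
  fix c :: real and x y :: "real ^ 'n"
  assume c: "0 < c" "c < 1"
  define X W Z where "X = x \<bullet> (B *v x)" and "W = (y - x) \<bullet> (B *v x)"
    and "Z = (y - x) \<bullet> (B *v (y - x))"
  have "c * (1 - c) * Z \<ge> 0"
    using c psd by (simp add: Z_def)
  then have "X + 2 * c * W + c\<^sup>2 * Z \<le> (1 - c) * X + c * (X + 2 * W + Z)"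
    by (simp add: power2_eq_square algebra_simps)
  moreover have "y \<bullet> (B *v y) = X + 2 * W + Z"
    using quadratic_form_add_scaled[OF sym, of x 1 "y - x"] by (simp add: X_def W_def Z_def)
  moreover have "(1 - c) *\<^sub>R x + c *\<^sub>R y = x + c *\<^sub>R (y - x)"
    by (simp add: algebra_simps)
  ultimately show "((1 - c) *\<^sub>R x + c *\<^sub>R y) \<bullet> (B *v ((1 - c) *\<^sub>R x + c *\<^sub>R y))
      \<le> (1 - c) * (x \<bullet> (B *v x)) + c * (y \<bullet> (B *v y))"
    using quadratic_form_add_scaled[OF sym, of x c "y - x"] by (simp only: X_def W_def Z_def)
qed simp

text \<open>Intermediate value theorem: the norm is at most 1 at parameter 0 and at least
  \<open>2 - norm y\<close>, hence at least 1, at parameter \<open>2 / norm d\<close>.\<close>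

lemma ray_meets_unit_sphere:
  fixes y d :: "'a::real_normed_vector"
  assumes "norm y \<le> 1" "d \<noteq> 0"
  obtains a where "0 \<le> a" "norm (y + a *\<^sub>R d) = 1"
proof -
  have "norm ((2 / norm d) *\<^sub>R d) \<le> norm (y + (2 / norm d) *\<^sub>R d) + norm y"
    by (metis add_diff_cancel_left' norm_triangle_ineq4)
  then have "1 \<le> norm (y + (2 / norm d) *\<^sub>R d)" using assms by simp
  then have "\<exists>a\<ge>0. a \<le> 2 / norm d \<and> norm (y + a *\<^sub>R d) = 1"
    using assms(1) by (intro IVT') (auto intro!: continuous_intros)
  then show ?thesis using that by blast
qed

text \<open>The weights \<open>c / (a + c)\<close> and \<open>a / (a + c)\<close> cancel the shifts;
  if both lengths are 0, then \<open>p\<close> itself lies in \<open>S\<close>.\<close>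

lemma point_in_convex_hull_of_opposite_shifts:
  fixes p v :: "'a::real_vector"
  assumes "0 \<le> a" "0 \<le> c" "p + a *\<^sub>R v \<in> S" "p - c *\<^sub>R v \<in> S"
  shows "p \<in> convex hull S"
proof (cases "a + c = 0")
  case True
  then have "a = 0" using assms by simp
  then show ?thesis using assms by (simp add: hull_inc)
next
  case False
  then have pos: "a + c > 0" using assms by simp
  have "(c / (a + c)) *\<^sub>R (p + a *\<^sub>R v) + (a / (a + c)) *\<^sub>R (p - c *\<^sub>R v) \<in> convex hull S"
    using assms pos
    by (intro convexD[OF convex_convex_hull] hull_inc) (auto simp: add_divide_distrib[symmetric])
  also have "(c / (a + c)) *\<^sub>R (p + a *\<^sub>R v) + (a / (a + c)) *\<^sub>R (p - c *\<^sub>R v)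
      = (c / (a + c) + a / (a + c)) *\<^sub>R p"
    by (simp add: algebra_simps)
  also have "\<dots> = p" using pos by (simp add: add.commute flip: add_divide_distrib)
  finally show ?thesis .
qed

lemma mem_F0_plus_H1: "(y, s, t) \<in> F0_plus \<inter> H1 \<longleftrightarrow> s = 1 \<and> norm y \<le> 1"
  by (auto simp: F0_plus_def H1_def abs_square_le_1)

theorem theorem13:
  fixes Q :: "real ^ 'n ^ 'n" and g :: "real ^ 'n"
    and A :: "real ^ 'n ^ 'm" and b :: "real ^ 'm" and K :: "(real ^ 'm) set"
  assumes "transpose Q = Q"
    and "min_eigenvalue Q < 0"
    and "closed K" and "convex_cone K"
    and "{y. norm y \<le> 1 \<and> A *v y - b \<in> K} \<noteq> {}"
    and "\<exists>d. d \<noteq> 0 \<and> Q *v d = min_eigenvalue Q *\<^sub>R d \<and> A *v d \<in> K \<and> - (A *v d) \<in> K"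
  shows "closure (convex hull (F0_plus \<inter> F1 Q g \<inter> K_hat A b K \<inter> H1))
    = F0_plus \<inter> Fs Q g \<inter> K_hat A b K \<inter> H1"
proof -
  define l where "l = min_eigenvalue Q"
  define B where "B = Q - l *\<^sub>R mat 1"
  define L where "L = F0_plus \<inter> F1 Q g \<inter> K_hat A b K \<inter> H1"
  define R where "R = F0_plus \<inter> Fs Q g \<inter> K_hat A b K \<inter> H1"
  have l: "l < 0" using assms(2) by (simp add: l_def)
  have symB: "transpose B = B" using assms(1) by (simp add: B_def transpose_shifted)
  have Bv: "B *v x = Q *v x - l *\<^sub>R x" for x by (simp add: B_def shifted_matrix_vector)
  have psd: "0 \<le> x \<bullet> (B *v x)" for x
    using min_eigenvalue_le_Rayleigh[OF assms(1), of x]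
    by (simp add: Bv inner_diff_right l_def)
  have memL: "(y, s, t) \<in> L \<longleftrightarrow>
      s = 1 \<and> norm y \<le> 1 \<and> A *v y - b \<in> K \<and> y \<bullet> (Q *v y) + 2 * (g \<bullet> y) \<le> t" for y s t
    using mem_F0_plus_H1[of y s t] by (auto simp: L_def F1_def K_hat_def)
  have memR: "(y, s, t) \<in> R \<longleftrightarrow>
      s = 1 \<and> norm y \<le> 1 \<and> A *v y - b \<in> K \<and> y \<bullet> (B *v y) + 2 * (g \<bullet> y) + l \<le> t" for y s t
    using mem_F0_plus_H1[of y s t] by (auto simp: R_def Fs_def K_hat_def B_def l_def)
  \<comment> \<open>This links the inequalities of \<open>Fs\<close> and \<open>F1\<close>: the
    correction is nonpositive on the unit ball and zero on the sphere.\<close>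
  have form_B: "y \<bullet> (B *v y) + l = y \<bullet> (Q *v y) + l * (1 - (norm y)\<^sup>2)" for y
    by (simp add: Bv inner_diff_right power2_norm_eq_inner algebra_simps)
  have cone: "convex K" "\<And>x y. x \<in> K \<Longrightarrow> y \<in> K \<Longrightarrow> x + y \<in> K"
    "\<And>c x. x \<in> K \<Longrightarrow> 0 \<le> c \<Longrightarrow> c *\<^sub>R x \<in> K"
    using assms(4) by (auto simp: convex_cone_def conic_def intro: convex_cone_add[OF assms(4)])

  have R_eq: "R = {p. fst (snd p) = 1} \<inter> {p. norm (fst p) \<le> 1} \<inter> {p. A *v fst p - b \<in> K}
      \<inter> {p. fst p \<bullet> (B *v fst p) + 2 * (g \<bullet> fst p) + l \<le> snd (snd p)}"
    using memR by auto
  have "closed R"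
  proof -
    have "closed ((\<lambda>p::'n point. A *v fst p - b) -` K)"
      using assms(3)
      by (intro continuous_closed_vimage)
        (auto intro!: continuous_intros bounded_linear.isCont[OF matrix_vector_mul_bounded_linear])
    then show ?thesis
      unfolding R_eq vimage_def
      by (intro closed_Int closed_Collect_eq closed_Collect_le continuous_intros
          bounded_linear.continuous_on[OF matrix_vector_mul_bounded_linear])
  qed
  moreover have "convex R"
  proof (rule convexI)
    fix p q :: "'n point" and u v :: real
    assume p: "p \<in> R" and q: "q \<in> R" and uv: "0 \<le> u" "0 \<le> v" "u + v = 1"
    obtain y t where p': "p = (y, 1, t)" using p memR by (cases p) auto
    obtain z r where q': "q = (z, 1, r)" using q memR by (cases q) auto
    note y = p[unfolded p' memR] and z = q[unfolded q' memR]
    have "u *\<^sub>R y + v *\<^sub>R z \<in> cball 0 1"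
      using y z uv by (intro convexD[OF convex_cball]) auto
    moreover have "A *v (u *\<^sub>R y + v *\<^sub>R z) - b = u *\<^sub>R (A *v y - b) + v *\<^sub>R (A *v z - b)"
    proof -
      have "v = 1 - u" using uv by simp
      then show ?thesis
        unfolding \<open>v = 1 - u\<close>
        by (simp add: matrix_vector_right_distrib matrix_vector_mult_scaleR algebra_simps)
    qed
    then have "A *v (u *\<^sub>R y + v *\<^sub>R z) - b \<in> K"
      using y z uv convexD[OF cone(1)] by simp
    moreover have "(u *\<^sub>R y + v *\<^sub>R z) \<bullet> (B *v (u *\<^sub>R y + v *\<^sub>R z))
        + 2 * (g \<bullet> (u *\<^sub>R y + v *\<^sub>R z)) + l \<le> u * t + v * r"
    proof -
      have "v = 1 - u" using uv by simp
      have "(u *\<^sub>R y + v *\<^sub>R z) \<bullet> (B *v (u *\<^sub>R y + v *\<^sub>R z))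
          \<le> u * (y \<bullet> (B *v y)) + v * (z \<bullet> (B *v z))"
        using convex_on_psd_quadratic_form[OF symB psd] uv by (simp add: convex_on_def)
      moreover have "u * (y \<bullet> (B *v y) + 2 * (g \<bullet> y) + l) \<le> u * t"
        "v * (z \<bullet> (B *v z) + 2 * (g \<bullet> z) + l) \<le> v * r"
        using y z uv by (auto intro!: mult_left_mono)
      \<comment> \<open>The constant \<open>l\<close> is split by the weights, so that the two
        scaled inequalities add up.\<close>
      moreover have "u * l + v * l = l" using uv by (simp flip: distrib_right)
      ultimately show ?thesis by (simp add: inner_add_right algebra_simps)
    qed
    ultimately show "u *\<^sub>R p + v *\<^sub>R q \<in> R"
      using uv by (simp add: p' q' memR)
  qed
  moreover have "L \<subseteq> R"
  proof
    fix p assume p: "p \<in> L"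
    obtain y s t where p': "p = (y, s, t)" by (cases p)
    have y: "norm y \<le> 1" using p p' memL by simp
    then have "l * (1 - (norm y)\<^sup>2) \<le> 0"
      using l by (simp add: mult_le_0_iff abs_square_le_1)
    then show "p \<in> R"
      using p form_B[of y] unfolding p' memL memR by linarith
  qed
  ultimately have "closure (convex hull L) \<subseteq> R"
    by (simp add: closure_minimal subset_hull)

  \<comment> \<open>Two points of \<open>L\<close> suffice for each point of \<open>R\<close>, so
    the convex hull reaches \<open>R\<close> before any closure is taken.\<close>
  moreover have "R \<subseteq> convex hull L"
  proof
    fix p assume p: "p \<in> R"
    obtain y t where p': "p = (y, 1, t)" using p memR by (cases p) auto
    note y = p[unfolded p' memR]
    obtain d where d: "d \<noteq> 0" "Q *v d = l *\<^sub>R d" "A *v d \<in> K" "- (A *v d) \<in> K"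
      using assms(6) l_def by blast
    have Bd: "B *v d = 0" using d(2) by (simp add: Bv)
    \<comment> \<open>Since \<open>B *v d = 0\<close>, the left-hand side of \<open>Fs\<close> has
      slope \<open>2 * (g \<bullet> d)\<close> along \<open>d\<close>. Letting the last coordinate
      grow at this rate preserves the slack.\<close>
    define w where "w = (d, 0::real, 2 * (g \<bullet> d))"
    have mem: "p + c *\<^sub>R w \<in> L" if c: "norm (y + c *\<^sub>R d) = 1" and K: "c *\<^sub>R (A *v d) \<in> K" for c
    proof -
      have "A *v (y + c *\<^sub>R d) - b = (A *v y - b) + c *\<^sub>R (A *v d)"
        by (simp add: matrix_vector_right_distrib matrix_vector_mult_scaleR)
      then have "A *v (y + c *\<^sub>R d) - b \<in> K" using cone(2) y K by metis
      moreover have "(y + c *\<^sub>R d) \<bullet> (B *v (y + c *\<^sub>R d)) = y \<bullet> (B *v y)"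
        unfolding quadratic_form_add_scaled[OF symB]
        using symmetric_inner_commute[OF symB, of d y] by (simp add: Bd)
      ultimately show ?thesis
        using c y form_B[of "y + c *\<^sub>R d"]
        by (simp add: p' w_def memL inner_add_right)
    qed
    obtain a where a: "0 \<le> a" "norm (y + a *\<^sub>R d) = 1"
      using ray_meets_unit_sphere y d(1) by metis
    obtain c where c: "0 \<le> c" "norm (y + c *\<^sub>R (- d)) = 1"
      using ray_meets_unit_sphere[of y "- d"] y d(1) by auto
    have "p + a *\<^sub>R w \<in> L" using mem a cone(3) d(3) by blast
    moreover have "p - c *\<^sub>R w \<in> L"
      \<comment> \<open>Moving backwards scales \<open>- (A *v d)\<close>, which lies in the cone as
        well, by a nonnegative factor.\<close>
      using mem[of "- c"] c cone(3)[OF d(4)] by simp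
    ultimately show "p \<in> convex hull L"
      using point_in_convex_hull_of_opposite_shifts a(1) c(1) by blast
  qed
  ultimately show ?thesis
    using closure_subset unfolding L_def R_def by blast
qed

end
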